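(* Let $K$ be a field, $P=K[x_1,\dots,x_n]$, $I\subset P$ a 0-dimensional ideal, and $R=P/I$. If $R$ has the strict Cayley-Bacharach property, then $R$ has the Cayley-Bacharach property.
   Context: Setting: $I$ is a proper ideal of $P=K[x_1,\dots,x_n]$ such that $\dim_K(P/I)<\infty$; $R=P/I$ is always considered with this fixed presentation. Degree filtration: $F_iP=\{f\in P\mid \deg f\le i\}\cup\{0\}$, $F_iI=F_iP\cap I$, and $F_iR=F_iP/F_iI$ is the image of $F_iP$ in $R$ ($i\in\mathbb Z$). $\mathrm{HF}^a_R(i)=\dim_K F_iR$. The regularity index is $\mathrm{ri}(R)=\min\{i\in\mathbb Z\mid \mathrm{HF}^a_R(j)=\dim_K R \text{ for all } j\ge i\}$. For $f\in R\setminus\{0\}$, $\mathrm{ord}_{\mathcal F}(f)=\min\{i\mid f\in F_iR\}$. Cayley-Bacharach property (CBP): let $I=\mathfrak Q_1\cap\dots\cap\mathfrak Q_s$ be the primary decomposition, $\mathfrak M_i=\mathrm{Rad}(\mathfrak Q_i)$ (maximal ideals), $\ell_i=\dim_K(P/\mathfrak M_i)$. A $\mathfrak Q_i$-divisor of $I$ is an ideal $J=\mathfrak Q_1\cap\dots\cap\mathfrak Q_i'\cap\dots\cap\mathfrak Q_s$ ($\mathfrak Q_i$ replaced by $\mathfrak Q_i'$), where $\mathfrak Q_i'$ is an ideal of $P$ with $\mathfrak Q_i\subsetneq\mathfrak Q_i'$ (so $\mathfrak Q_i'\subseteq\mathfrak M_i$ or $\mathfrak Q_i'=P$). It is minimal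 if $\dim_K(J/I)=\ell_i$. For a minimal $\mathfrak Q_i$-divisor $J$ with image $\bar J=J/I$ in $R$, put $\mathrm{ri}(\bar J)=\max\{\mathrm{ord}_{\mathcal F}(f)\mid f\in\bar J\setminus\{0\}\}$. $R$ has the CBP if for every $i\in\{1,\dots,s\}$ and every minimal $\mathfrak Q_i$-divisor $J$ of $I$ we have $\mathrm{ri}(\bar J)=\mathrm{ri}(R)$. Graded ring: $\mathrm{gr}_{\mathcal F}(R)=\bigoplus_{i\in\mathbb Z}F_iR/F_{i-1}R\cong P/\mathrm{DF}(I)$, where $\mathrm{DF}(I)$ is the ideal generated by the degree forms (top-degree homogeneous components) of the non-zero elements of $I$; it is a 0-dimensional affine $K$-algebra considered with the presentation $P/\mathrm{DF}(I)$. $R$ has the strict Cayley-Bacharach property if $\mathrm{gr}_{\mathcal F}(R)=P/\mathrm{DF}(I)$ has the CBP. *)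

theory Defs
  imports
    "HOL-Library.Poly_Mapping"
    "HOL-Algebra.Embedded_Algebras"
    "HOL-Algebra.QuotRing"
    "HOL-Algebra.Algebraic_Closure_Type"
begin

section \<open>The polynomial ring and its degree filtration\<close>

text \<open>
  An exponent vector is a finitely supported map from the finite, nonempty type \<open>'x\<close> of
  indeterminates to the natural numbers; a polynomial is a finitely supported map from exponent
  vectors to the field \<open>'k\<close>. The product of \<^theory>\<open>HOL-Library.Poly_Mapping\<close> is the
  convolution product, so this is $K[x_1,\dots,x_n]$ with $n$ the cardinality of \<open>'x\<close>.
\<close>

type_synonym ('x, 'k) mpoly = "('x \<Rightarrow>\<^sub>0 nat) \<Rightarrow>\<^sub>0 'k"

abbreviation poly_ring :: "('x::finite, 'k::field) mpoly ring"
  where "poly_ring \<equiv> ring_of_type_algebra"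

definition const_poly :: "'k::field \<Rightarrow> ('x::finite, 'k) mpoly"
  where "const_poly c = Poly_Mapping.single 0 c"

definition monom_degree :: "('x::finite \<Rightarrow>\<^sub>0 nat) \<Rightarrow> nat"
  where "monom_degree m = (\<Sum>x\<in>UNIV. Poly_Mapping.lookup m x)"

text \<open>The total degree; only meaningful for nonzero polynomials.\<close>

definition total_degree :: "('x::finite, 'k::field) mpoly \<Rightarrow> nat"
  where "total_degree p = Max (monom_degree ` Poly_Mapping.keys p)"

definition filt_poly :: "int \<Rightarrow> ('x::finite, 'k::field) mpoly set"
  where "filt_poly i = {p. p \<noteq> 0 \<and> int (total_degree p) \<le> i} \<union> {0}"

definition degree_form :: "('x::finite, 'k::field) mpoly \<Rightarrow> ('x, 'k) mpoly"
  where "degree_form p =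
    (\<Sum>m | m \<in> Poly_Mapping.keys p \<and> monom_degree m = total_degree p.
       Poly_Mapping.single m (Poly_Mapping.lookup p m))"

definition degree_form_ideal :: "('x::finite, 'k::field) mpoly set \<Rightarrow> ('x, 'k) mpoly set"
  where "degree_form_ideal I = Idl\<^bsub>poly_ring\<^esub> {degree_form f | f. f \<in> I \<and> f \<noteq> 0}"


section \<open>The affine algebra $R = P/I$\<close>

text \<open>Elements of $P/I$ are cosets; every notion below depends on \<open>I\<close>, that is, on the
  fixed presentation of the algebra.\<close>

definition quot_alg :: "('x::finite, 'k::field) mpoly set \<Rightarrow> ('x, 'k) mpoly set ring"
  where "quot_alg I = poly_ring Quot I"

definition image_in :: "('x::finite, 'k::field) mpoly set \<Rightarrow> ('x, 'k) mpoly set \<Rightarrow> ('x, 'k) mpoly set set"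
  where "image_in I V = (\<lambda>p. I +>\<^bsub>poly_ring\<^esub> p) ` V"

text \<open>The field $K$, viewed as a subring of $P/I$.\<close>

definition base_field :: "('x::finite, 'k::field) mpoly set \<Rightarrow> ('x, 'k) mpoly set set"
  where "base_field I = image_in I (range const_poly)"

text \<open>The $K$-dimension of a $K$-linear subspace of $P/I$ (unspecified when infinite).\<close>

definition kdim :: "('x::finite, 'k::field) mpoly set \<Rightarrow> ('x, 'k) mpoly set set \<Rightarrow> nat"
  where "kdim I V = ring.dim (quot_alg I) (base_field I) V"

definition zero_dimensional :: "('x::finite, 'k::field) mpoly set \<Rightarrow> bool"
  where "zero_dimensional I \<longleftrightarrow>
    ideal I poly_ring \<and> I \<noteq> carrier poly_ring \<and>
    ring.finite_dimension (quot_alg I) (base_field I) (carrier (quot_alg I))"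

definition filt_quot :: "('x::finite, 'k::field) mpoly set \<Rightarrow> int \<Rightarrow> ('x, 'k) mpoly set set"
  where "filt_quot I i = image_in I (filt_poly i)"

definition affine_HF :: "('x::finite, 'k::field) mpoly set \<Rightarrow> int \<Rightarrow> nat"
  where "affine_HF I i = kdim I (filt_quot I i)"

definition reg_index :: "('x::finite, 'k::field) mpoly set \<Rightarrow> int"
  where "reg_index I = (LEAST i. \<forall>j\<ge>i. affine_HF I j = kdim I (carrier (quot_alg I)))"

definition filt_ord :: "('x::finite, 'k::field) mpoly set \<Rightarrow> ('x, 'k) mpoly set \<Rightarrow> int"
  where "filt_ord I f = (LEAST i. f \<in> filt_quot I i)"

text \<open>The regularity index of an ideal \<open>B\<close> of $P/I$.\<close>

definition reg_index_ideal :: "('x::finite, 'k::field) mpoly set \<Rightarrow> ('x, 'k) mpoly set set \<Rightarrow> int"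
  where "reg_index_ideal I B = Max {filt_ord I f | f. f \<in> B \<and> f \<noteq> \<zero>\<^bsub>quot_alg I\<^esub>}"


section \<open>Primary decomposition\<close>

definition radical :: "('a, 'b) ring_scheme \<Rightarrow> 'a set \<Rightarrow> 'a set"
  where "radical R I = {a \<in> carrier R. \<exists>n::nat. a [^]\<^bsub>R\<^esub> n \<in> I}"

definition primary_ideal :: "'a set \<Rightarrow> ('a, 'b) ring_scheme \<Rightarrow> bool"
  where "primary_ideal Q R \<longleftrightarrow> ideal Q R \<and> Q \<noteq> carrier R \<and>
    (\<forall>a\<in>carrier R. \<forall>b\<in>carrier R. a \<otimes>\<^bsub>R\<^esub> b \<in> Q \<longrightarrow> a \<in> Q \<or> b \<in> radical R Q)"

text \<open>Reduced primary decompositions: distinct radicals, no redundant component.\<close>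

definition primary_decomposition :: "('a, 'b) ring_scheme \<Rightarrow> 'a set \<Rightarrow> 'a set set \<Rightarrow> bool"
  where "primary_decomposition R I \<Q> \<longleftrightarrow>
    finite \<Q> \<and> (\<forall>Q\<in>\<Q>. primary_ideal Q R) \<and> \<Inter>\<Q> = I \<and>
    inj_on (radical R) \<Q> \<and> (\<forall>Q\<in>\<Q>. \<Inter>(\<Q> - {Q}) \<noteq> I)"


section \<open>The Cayley-Bacharach property\<close>

definition Q_divisor ::
  "('x::finite, 'k::field) mpoly set set \<Rightarrow> ('x, 'k) mpoly set \<Rightarrow> ('x, 'k) mpoly set \<Rightarrow> bool"
  where "Q_divisor \<Q> Q J \<longleftrightarrow>
    (\<exists>Q'. ideal Q' poly_ring \<and> Q \<subset> Q' \<and> J = Q' \<inter> \<Inter>(\<Q> - {Q}))"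

definition minimal_Q_divisor ::
  "('x::finite, 'k::field) mpoly set \<Rightarrow> ('x, 'k) mpoly set set \<Rightarrow>
   ('x, 'k) mpoly set \<Rightarrow> ('x, 'k) mpoly set \<Rightarrow> bool"
  where "minimal_Q_divisor I \<Q> Q J \<longleftrightarrow> Q_divisor \<Q> Q J \<and>
    kdim I (image_in I J) =
      (let M = radical poly_ring Q in kdim M (carrier (quot_alg M)))"

text \<open>
  A zero-dimensional ideal has exactly one reduced primary decomposition, since all its
  associated primes are maximal; the quantifier over \<open>\<Q>\<close> ranges over just this one.
\<close>

definition CBP :: "('x::finite, 'k::field) mpoly set \<Rightarrow> bool"
  where "CBP I \<longleftrightarrow>
    (\<forall>\<Q>. primary_decomposition poly_ring I \<Q> \<longrightarrow>
      (\<forall>Q\<in>\<Q>. \<forall>J. minimal_Q_divisor I \<Q> Q J \<longrightarrow>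
         reg_index_ideal I (image_in I J) = reg_index I))"

text \<open>The associated graded ring of $P/I$ is considered with its presentation
  $P/\mathrm{DF}(I)$.\<close>

definition strict_CBP :: "('x::finite, 'k::field) mpoly set \<Rightarrow> bool"
  where "strict_CBP I \<longleftrightarrow> CBP (degree_form_ideal I)"

end

(*
  Let J strictly contain I, let e be the largest order of an element of J outside I modulo I, and
  let f in J attain it with deg f = e. Every multiple x_j f is in J, hence congruent modulo I to a
  polynomial of degree at most e, so x_j DF(f) lies in DF(I), while DF(f) itself does not: DF(f) is
  a socle element of P/DF(I). Since P/DF(I) is local with residue field K, its line is a minimal
  divisor of DF(I), and strict CBP gives e = ri(P/DF(I)). Finally ri(P/DF(I)) = ri(R), because the
  polynomials of degree at most d span P modulo I iff they do so modulo DF(I).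
*)

theory Submission
  imports Defs
begin

section \<open>Ideals of commutative rings given by type classes\<close>

text \<open>DF(f) avoids DF(I) because e is an order, not merely a degree: an element of I with the
  same top form could be subtracted from f and would lower the order. Maximality of e is what bounds
  the order of x_j f, whose degree may be e+1. A minimal divisor strictly contains I because the
  dimension of J/I is a residue degree, hence positive. Locality of P/DF(I) comes from spanning: if
  the polynomials of degree at most d span P modulo I, every term of degree above d lies in DF(I).
  The obstacle is that taking top forms is not additive, so membership in the generated ideal DF(I)
  is awkward to test. Components of a prescribed degree, together with degree bounds that zero also
  satisfies, are additive and give a criterion for membership one degree at a time.\<close>

lemma ring_of_type_algebra_simps [simp]:
  "carrier (ring_of_type_algebra :: 'a::comm_ring_1 ring) = UNIV"
  "x \<otimes>\<^bsub>ring_of_type_algebra\<^esub> y = x * y"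
  "x \<oplus>\<^bsub>ring_of_type_algebra\<^esub> y = x + y"
  "\<one>\<^bsub>ring_of_type_algebra\<^esub> = (1 :: 'a)"
  "\<zero>\<^bsub>ring_of_type_algebra\<^esub> = (0 :: 'a)"
  by (simp_all add: ring_of_type_algebra_def)

lemma a_inv_ring_of_type_algebra [simp]:
  "\<ominus>\<^bsub>ring_of_type_algebra\<^esub> (x :: 'a::comm_ring_1) = - x"
proof -
  interpret ring "ring_of_type_algebra :: 'a ring" by (rule ring_from_type_algebra)
  show ?thesis
    using minus_equality[of "- x" x] by simp
qed

lemma nat_pow_ring_of_type_algebra [simp]:
  "(x :: 'a::comm_ring_1) [^]\<^bsub>ring_of_type_algebra\<^esub> (n :: nat) = x ^ n"
proof -
  interpret ring "ring_of_type_algebra :: 'a ring" by (rule ring_from_type_algebra)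
  show ?thesis by (induction n) (simp_all add: mult.commute)
qed

text \<open>Closure under negation is multiplication by -1, so three closure conditions
  suffice.\<close>

lemma ideal_ring_of_type_algebra_iff:
  fixes I :: "'a::comm_ring_1 set"
  shows "ideal I ring_of_type_algebra \<longleftrightarrow>
    0 \<in> I \<and> (\<forall>a\<in>I. \<forall>b\<in>I. a + b \<in> I) \<and> (\<forall>a\<in>I. \<forall>r. r * a \<in> I)"
    (is "?L \<longleftrightarrow> ?R")
proof
  assume ?L
  then interpret ideal I "ring_of_type_algebra :: 'a ring" .
  show ?R
    using additive_subgroup.zero_closed[OF is_additive_subgroup]
      additive_subgroup.a_closed[OF is_additive_subgroup] I_l_closed by auto
next
  assume R: ?R
  interpret ring "ring_of_type_algebra :: 'a ring" by (rule ring_from_type_algebra)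
  show ?L
  proof (rule idealI)
    show "subgroup I (add_monoid (ring_of_type_algebra :: 'a ring))"
    proof (rule add.subgroupI)
      show "\<ominus>\<^bsub>ring_of_type_algebra\<^esub> a \<in> I" if "a \<in> I" for a
        using R that by (metis a_inv_ring_of_type_algebra mult_minus1)
    qed (use R in auto)
  qed (use R in \<open>auto simp: mult.commute ring_axioms\<close>)
qed

lemma
  fixes I :: "'a::comm_ring_1 set"
  assumes "ideal I ring_of_type_algebra"
  shows ideal_zero_mem: "0 \<in> I"
    and ideal_add_mem: "a \<in> I \<Longrightarrow> b \<in> I \<Longrightarrow> a + b \<in> I"
    and ideal_mult_mem: "a \<in> I \<Longrightarrow> r * a \<in> I"
    and ideal_diff_mem: "a \<in> I \<Longrightarrow> b \<in> I \<Longrightarrow> a - b \<in> I"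
proof -
  note R = assms[unfolded ideal_ring_of_type_algebra_iff]
  show "0 \<in> I" "a \<in> I \<Longrightarrow> b \<in> I \<Longrightarrow> a + b \<in> I" "a \<in> I \<Longrightarrow> r * a \<in> I"
    using R by auto
  show "a \<in> I \<Longrightarrow> b \<in> I \<Longrightarrow> a - b \<in> I"
    using R by (metis diff_conv_add_uminus mult_minus1)
qed

lemma ideal_sum_mem:
  fixes I :: "'a::comm_ring_1 set"
  assumes "ideal I ring_of_type_algebra" "\<And>x. x \<in> A \<Longrightarrow> f x \<in> I"
  shows "sum f A \<in> I"
  using assms(2)
  by (induction A rule: infinite_finite_induct)
    (auto intro: ideal_zero_mem[OF assms(1)] ideal_add_mem[OF assms(1)])

lemma ideal_ne_carrier_iff:
  fixes I :: "'a::comm_ring_1 set"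
  assumes "ideal I ring_of_type_algebra"
  shows "I \<noteq> UNIV \<longleftrightarrow> 1 \<notin> I"
  using ideal_mult_mem[OF assms, of 1] by auto

lemma a_r_coset_ring_of_type_algebra:
  "I +>\<^bsub>ring_of_type_algebra\<^esub> (p :: 'a::comm_ring_1) = {q. q - p \<in> I}"
proof -
  have "I +>\<^bsub>ring_of_type_algebra\<^esub> p = (\<lambda>i. i + p) ` I"
    by (auto simp: a_r_coset_def r_coset_def)
  also have "\<dots> = {q. q - p \<in> I}"
    by (force simp: image_iff)
  finally show ?thesis .
qed

lemma a_r_coset_eq_iff:
  fixes I :: "'a::comm_ring_1 set"
  assumes "ideal I ring_of_type_algebra"
  shows "I +>\<^bsub>ring_of_type_algebra\<^esub> p = I +>\<^bsub>ring_of_type_algebra\<^esub> q \<longleftrightarrow> p - q \<in> I"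
proof
  assume "I +>\<^bsub>ring_of_type_algebra\<^esub> p = I +>\<^bsub>ring_of_type_algebra\<^esub> q"
  then show "p - q \<in> I"
    using ideal_zero_mem[OF assms] unfolding a_r_coset_ring_of_type_algebra
    by (metis (mono_tags, lifting) diff_self mem_Collect_eq)
next
  assume "p - q \<in> I"
  then have "r - p \<in> I \<longleftrightarrow> r - q \<in> I" for r
    using ideal_add_mem[OF assms, of "r - p" "p - q"] ideal_diff_mem[OF assms, of "r - q" "p - q"]
    by (auto simp: algebra_simps)
  then show "I +>\<^bsub>ring_of_type_algebra\<^esub> p = I +>\<^bsub>ring_of_type_algebra\<^esub> q"
    by (auto simp: a_r_coset_ring_of_type_algebra)
qed

lemma a_r_coset_zero:
  assumes "ideal (I :: 'a::comm_ring_1 set) ring_of_type_algebra"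
  shows "I +>\<^bsub>ring_of_type_algebra\<^esub> p = I \<longleftrightarrow> p \<in> I"
proof -
  have "I = I +>\<^bsub>ring_of_type_algebra\<^esub> 0"
    by (simp add: a_r_coset_ring_of_type_algebra)
  then show ?thesis
    using a_r_coset_eq_iff[OF assms, of p 0] by simp
qed

lemma ideal_Inter:
  fixes \<I> :: "'a::comm_ring_1 set set"
  assumes "\<And>I. I \<in> \<I> \<Longrightarrow> ideal I ring_of_type_algebra"
  shows "ideal (\<Inter>\<I>) ring_of_type_algebra"
  using assms unfolding ideal_ring_of_type_algebra_iff by blast

text \<open>In each term of the binomial expansion of \<open>(a + b) ^ (n + m)\<close>, either
  \<open>a\<close> has exponent at least \<open>n\<close> or \<open>b\<close> has exponent at least
  \<open>m\<close>.\<close>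

lemma ideal_radical:
  fixes Q :: "'a::comm_ring_1 set"
  assumes Q: "ideal Q ring_of_type_algebra"
  shows "ideal (radical ring_of_type_algebra Q) ring_of_type_algebra"
  unfolding ideal_ring_of_type_algebra_iff
proof (intro conjI ballI allI)
  show "0 \<in> radical ring_of_type_algebra Q"
    using ideal_zero_mem[OF Q] by (auto simp: radical_def intro!: exI[of _ 1])
  show "a + b \<in> radical ring_of_type_algebra Q"
    if ab: "a \<in> radical ring_of_type_algebra Q" "b \<in> radical ring_of_type_algebra Q" for a b
  proof -
    obtain n m where nm: "a ^ n \<in> Q" "b ^ m \<in> Q"
      using ab by (auto simp: radical_def)
    have "of_nat (n + m choose k) * a ^ k * b ^ (n + m - k) \<in> Q" for k
    proof (cases "n \<le> k")
      case True
      then have "a ^ k = a ^ (k - n) * a ^ n"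
        by (simp flip: power_add)
      then have "of_nat (n + m choose k) * a ^ k * b ^ (n + m - k) =
          (of_nat (n + m choose k) * a ^ (k - n) * b ^ (n + m - k)) * a ^ n"
        by (simp add: mult_ac)
      then show ?thesis using ideal_mult_mem[OF Q nm(1)] by simp
    next
      case False
      then have "b ^ (n + m - k) = b ^ (n - k) * b ^ m"
        by (simp flip: power_add)
      then have "of_nat (n + m choose k) * a ^ k * b ^ (n + m - k) =
          (of_nat (n + m choose k) * a ^ k * b ^ (n - k)) * b ^ m"
        by (simp add: mult_ac)
      then show ?thesis using ideal_mult_mem[OF Q nm(2)] by simp
    qed
    then have "(a + b) ^ (n + m) \<in> Q"
      unfolding binomial_ring by (intro ideal_sum_mem[OF Q])
    then show ?thesis by (auto simp: radical_def)
  qed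
  show "r * a \<in> radical ring_of_type_algebra Q"
    if "a \<in> radical ring_of_type_algebra Q" for a r
    using that ideal_mult_mem[OF Q] by (auto simp: radical_def power_mult_distrib)
qed

section \<open>Degrees and homogeneous components\<close>

lemma mpoly_eq_sum_single:
  "p = (\<Sum>m\<in>Poly_Mapping.keys p. Poly_Mapping.single m (Poly_Mapping.lookup p m))"
proof (rule poly_mapping_eqI)
  fix m
  show "Poly_Mapping.lookup p m = Poly_Mapping.lookup
      (\<Sum>m\<in>Poly_Mapping.keys p. Poly_Mapping.single m (Poly_Mapping.lookup p m)) m"
    by (simp add: lookup_sum lookup_single when_def in_keys_iff)
qed

text \<open>Reduces additive statements to single terms; in particular, multiplication by a
  polynomial becomes multiplication by a term.\<close>

lemma mpoly_induct [case_names zero add single]: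
  fixes p :: "'a \<Rightarrow>\<^sub>0 'b::comm_monoid_add"
  assumes "Q 0" "\<And>p q. Q p \<Longrightarrow> Q q \<Longrightarrow> Q (p + q)" "\<And>m c. Q (Poly_Mapping.single m c)"
  shows "Q p"
proof -
  have "Q (\<Sum>m\<in>A. Poly_Mapping.single m (Poly_Mapping.lookup p m))" for A
    by (induction A rule: infinite_finite_induct) (auto intro: assms)
  then show ?thesis
    by (subst mpoly_eq_sum_single)
qed

section \<open>Degrees of exponent vectors and degree bounds\<close>

lemma monom_degree_add [simp]: "monom_degree (m + m') = monom_degree m + monom_degree m'"
  by (simp add: monom_degree_def lookup_add sum.distrib)

lemma monom_degree_zero [simp]: "monom_degree 0 = 0"
  by (simp add: monom_degree_def)

lemma monom_degree_single [simp]: "monom_degree (Poly_Mapping.single x n) = n"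
  by (simp add: monom_degree_def lookup_single when_def)

lemma monom_degree_eq_0_iff [simp]: "monom_degree m = 0 \<longleftrightarrow> m = 0"
  by (auto simp: monom_degree_def poly_mapping_eq_iff fun_eq_iff)

lemma finite_monom_degree_le: "finite {m :: 'x::finite \<Rightarrow>\<^sub>0 nat. monom_degree m \<le> d}"
proof -
  have "Poly_Mapping.lookup m x \<le> monom_degree m" for m :: "'x \<Rightarrow>\<^sub>0 nat" and x
    unfolding monom_degree_def by (intro member_le_sum) auto
  then have "Poly_Mapping.lookup ` {m :: 'x \<Rightarrow>\<^sub>0 nat. monom_degree m \<le> d} \<subseteq> PiE UNIV (\<lambda>_. {..d})"
    by (auto simp: PiE_def extensional_def intro: order_trans)
  then have "finite (Poly_Mapping.lookup ` {m :: 'x \<Rightarrow>\<^sub>0 nat. monom_degree m \<le> d})"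
    by (rule finite_subset) (simp add: finite_PiE)
  then show ?thesis
    by (rule finite_imageD) (rule inj_onI, rule poly_mapping_eqI, rule fun_cong)
qed

text \<open>Unlike a bound on \<open>total_degree\<close>, which is a maximum over the empty set at
  0, this holds for 0 and therefore defines a subspace.\<close>

definition degree_le :: "nat \<Rightarrow> ('x::finite, 'k::field) mpoly \<Rightarrow> bool"
  where "degree_le d p \<longleftrightarrow> (\<forall>m\<in>Poly_Mapping.keys p. monom_degree m \<le> d)"

definition degree_ge :: "nat \<Rightarrow> ('x::finite, 'k::field) mpoly \<Rightarrow> bool"
  where "degree_ge d p \<longleftrightarrow> (\<forall>m\<in>Poly_Mapping.keys p. d \<le> monom_degree m)"

lemma degree_le_total_degree: "degree_le (total_degree p) p"
  by (simp add: degree_le_def total_degree_def)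

lemma filt_poly_of_nat: "filt_poly (int d) = {p. degree_le d p}"
  by (auto simp: filt_poly_def degree_le_def total_degree_def)

lemma filt_poly_neg: "i < 0 \<Longrightarrow> filt_poly i = {0}"
  by (auto simp: filt_poly_def)

lemma degree_le_zero [simp]: "degree_le d 0"
  by (simp add: degree_le_def)

lemma degree_le_mono: "degree_le d p \<Longrightarrow> d \<le> e \<Longrightarrow> degree_le e p"
  by (auto simp: degree_le_def)

lemma degree_le_add: "degree_le d p \<Longrightarrow> degree_le d q \<Longrightarrow> degree_le d (p + q)"
  using Poly_Mapping.keys_add[of p q] by (auto simp: degree_le_def)

lemma degree_le_uminus [simp]: "degree_le d (- p) \<longleftrightarrow> degree_le d p"
  by (simp add: degree_le_def in_keys_iff)

lemma degree_le_diff: "degree_le d p \<Longrightarrow> degree_le d q \<Longrightarrow> degree_le d (p - q)"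
  using degree_le_add[of d p "- q"] by simp

lemma degree_le_mult: "degree_le d p \<Longrightarrow> degree_le e q \<Longrightarrow> degree_le (d + e) (p * q)"
  using keys_mult[of p q] unfolding degree_le_def by (fastforce intro: add_mono)

lemma degree_ge_mult: "degree_ge d p \<Longrightarrow> degree_ge e q \<Longrightarrow> degree_ge (d + e) (p * q)"
  using keys_mult[of p q] unfolding degree_ge_def by (fastforce intro: add_mono)

lemma degree_ge_power:
  assumes "degree_ge 1 p"
  shows "degree_ge k (p ^ k)"
proof (induction k)
  case 0
  show ?case by (simp add: degree_ge_def)
next
  case (Suc k)
  show ?case using degree_ge_mult[OF assms Suc] by simp
qed

lemma degree_le_single: "monom_degree m \<le> d \<Longrightarrow> degree_le d (Poly_Mapping.single m c)"
  by (auto simp: degree_le_def)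

lemma degree_le_const_poly [simp]: "degree_le d (const_poly c)"
  by (simp add: const_poly_def degree_le_single)

lemma degree_le_const_poly_mult: "degree_le d p \<Longrightarrow> degree_le d (const_poly c * p)"
  using degree_le_mult[OF degree_le_const_poly, of d p 0 c] by simp

text \<open>Fixing the degree \<open>e\<close> in advance makes this linear in \<open>p\<close>,
  which \<open>degree_form\<close> is not when top terms cancel.\<close>

definition hom_comp :: "nat \<Rightarrow> ('x::finite, 'k::field) mpoly \<Rightarrow> ('x, 'k) mpoly"
  where "hom_comp e p = (\<Sum>m | m \<in> Poly_Mapping.keys p \<and> monom_degree m = e.
    Poly_Mapping.single m (Poly_Mapping.lookup p m))"

lemma lookup_hom_comp:
  "Poly_Mapping.lookup (hom_comp e p) m = (if monom_degree m = e then Poly_Mapping.lookup p m else 0)"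
  by (simp add: hom_comp_def lookup_sum lookup_single when_def in_keys_iff)

lemma degree_form_eq_hom_comp: "degree_form p = hom_comp (total_degree p) p"
  by (simp add: degree_form_def hom_comp_def)

lemma hom_comp_zero [simp]: "hom_comp e 0 = 0"
  by (simp add: hom_comp_def)

lemma hom_comp_add: "hom_comp e (p + q) = hom_comp e p + hom_comp e q"
  by (rule poly_mapping_eqI) (simp add: lookup_hom_comp lookup_add)

lemma hom_comp_diff: "hom_comp e (p - q) = hom_comp e p - hom_comp e q"
  by (rule poly_mapping_eqI) (simp add: lookup_hom_comp lookup_minus)

lemma hom_comp_single:
  "hom_comp e (Poly_Mapping.single m c) = (if monom_degree m = e then Poly_Mapping.single m c else 0)"
  by (rule poly_mapping_eqI) (auto simp: lookup_hom_comp lookup_single when_def)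

lemma hom_comp_hom_comp: "hom_comp d (hom_comp e p) = (if d = e then hom_comp e p else 0)"
  by (rule poly_mapping_eqI) (auto simp: lookup_hom_comp)

lemma hom_comp_eq_0: "degree_le d p \<Longrightarrow> d < e \<Longrightarrow> hom_comp e p = 0"
  by (rule poly_mapping_eqI) (force simp: lookup_hom_comp degree_le_def in_keys_iff)

lemma degree_le_hom_comp [simp]: "degree_le e (hom_comp e p)"
  unfolding degree_le_def by (metis in_keys_iff lookup_hom_comp order_refl)

lemma degree_le_Suc_iff: "degree_le d p \<longleftrightarrow> degree_le (Suc d) p \<and> hom_comp (Suc d) p = 0"
  by (force simp: degree_le_def in_keys_iff poly_mapping_eq_iff fun_eq_iff lookup_hom_comp le_Suc_eq)

lemma mpoly_eq_sum_hom_comp: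
  assumes "degree_le d p"
  shows "p = (\<Sum>e\<le>d. hom_comp e p)"
proof (rule poly_mapping_eqI)
  fix m
  show "Poly_Mapping.lookup p m = Poly_Mapping.lookup (\<Sum>e\<le>d. hom_comp e p) m"
    using assms by (auto simp: lookup_sum lookup_hom_comp degree_le_def in_keys_iff)
qed

text \<open>A term shifts degrees by its own degree; the case distinction guards the truncated
  subtraction.\<close>

lemma hom_comp_single_mult:
  "hom_comp e (Poly_Mapping.single m c * p) =
    (if monom_degree m \<le> e then Poly_Mapping.single m c * hom_comp (e - monom_degree m) p else 0)"
proof (induction p rule: mpoly_induct)
  case zero
  show ?case by simp
next
  case (add p q)
  then show ?case by (simp add: hom_comp_add distrib_left)
next
  case (single m' c')
  show ?case by (auto simp: mult_single hom_comp_single)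
qed

lemma total_degree_eq:
  assumes "degree_le e p" "hom_comp e p \<noteq> 0"
  shows "total_degree p = e"
proof (rule antisym)
  obtain m where m: "m \<in> Poly_Mapping.keys p" "monom_degree m = e"
    using assms(2) by (metis in_keys_iff lookup_hom_comp lookup_zero poly_mapping_eqI)
  show "e \<le> total_degree p"
    using m unfolding total_degree_def by (auto intro!: Max_ge)
  have "Poly_Mapping.keys p \<noteq> {}"
    using m by auto
  then show "total_degree p \<le> e"
    using assms(1) by (simp add: degree_le_def total_degree_def)
qed

section \<open>The degree form ideal\<close>

text \<open>The polynomials satisfying the right-hand side form an ideal containing all degree
  forms. Since \<open>g\<close> need only have degree at most \<open>e\<close>, cancellation of top
  forms does no harm and sums of witnesses are witnesses. Conversely, each nonzero component of
  \<open>f\<close> is the degree form of its witness.\<close>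

lemma degree_form_ideal_iff:
  fixes I :: "('x::finite, 'k::field) mpoly set"
  assumes I: "ideal I poly_ring"
  shows "f \<in> degree_form_ideal I \<longleftrightarrow> (\<forall>e. \<exists>g\<in>I. degree_le e g \<and> hom_comp e g = hom_comp e f)"
proof
  interpret ring "poly_ring :: ('x, 'k) mpoly ring" by (rule ring_from_type_algebra)
  let ?G = "{degree_form f | f. f \<in> I \<and> f \<noteq> 0}"
  let ?C = "\<lambda>e f. \<exists>g\<in>I. degree_le e g \<and> hom_comp e g = hom_comp e f"
  have C_zero: "?C e 0" for e
    by (rule bexI[of _ 0]) (use ideal_zero_mem[OF I] in auto)
  have C_add: "?C e (p + q)" if p: "?C e p" and q: "?C e q" for e p q
  proof -
    obtain g h where "g \<in> I" "degree_le e g" "hom_comp e g = hom_comp e p"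
      "h \<in> I" "degree_le e h" "hom_comp e h = hom_comp e q"
      using p q by blast
    then show ?thesis
      by (intro bexI[of _ "g + h"]) (auto simp: hom_comp_add degree_le_add ideal_add_mem[OF I])
  qed
  have mult: "\<forall>e. ?C e (r * p)" if p: "\<forall>e. ?C e p" for r p
  proof (induction r rule: mpoly_induct)
    case zero
    show ?case unfolding mult_zero_left using C_zero by blast
  next
    case (add r s)
    then show ?case by (simp add: distrib_right C_add)
  next
    case (single m c)
    show ?case
    proof
      fix e
      show "?C e (Poly_Mapping.single m c * p)"
      proof (cases "monom_degree m \<le> e")
        case True
        obtain g where g: "g \<in> I" "degree_le (e - monom_degree m) g"
          "hom_comp (e - monom_degree m) g = hom_comp (e - monom_degree m) p"
          using p by blast
        have "degree_le e (Poly_Mapping.single m c * g)"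
          using degree_le_mult[OF degree_le_single[OF order_refl] g(2), of m c] True by simp
        then show ?thesis
          using g True ideal_mult_mem[OF I]
          by (intro bexI[of _ "Poly_Mapping.single m c * g"]) (auto simp: hom_comp_single_mult)
      next
        case False
        then show ?thesis
          using C_zero[of e] by (simp add: hom_comp_single_mult)
      qed
    qed
  qed
  have S: "ideal {f. \<forall>e. ?C e f} poly_ring"
    unfolding ideal_ring_of_type_algebra_iff using C_zero C_add mult by auto
  \<comment> \<open>A degree form has one nonzero component, witnessed by \<open>f\<close> itself;
    all others are 0.\<close>
  have "?G \<subseteq> {f. \<forall>e. ?C e f}"
  proof (clarify)
    fix f e
    assume "f \<in> I" "f \<noteq> 0"
    then show "?C e (degree_form f)"
      using C_zero[of e] degree_le_total_degree[of f]
      by (cases "e = total_degree f") (auto simp: degree_form_eq_hom_comp hom_comp_hom_comp)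
  qed
  then have "degree_form_ideal I \<subseteq> {f. \<forall>e. ?C e f}"
    unfolding degree_form_ideal_def by (rule genideal_minimal[OF S])
  then show "\<forall>e. ?C e f" if "f \<in> degree_form_ideal I"
    using that by blast
  have D: "ideal (degree_form_ideal I) poly_ring"
    unfolding degree_form_ideal_def by (rule genideal_ideal) auto
  have G: "?G \<subseteq> degree_form_ideal I"
    unfolding degree_form_ideal_def by (rule genideal_self) auto
  show "f \<in> degree_form_ideal I" if f: "\<forall>e. ?C e f"
  proof -
    have "hom_comp e f \<in> degree_form_ideal I" for e
    proof (cases "hom_comp e f = 0")
      case True
      then show ?thesis using ideal_zero_mem[OF D] by simp
    next
      case False
      obtain g where g: "g \<in> I" "degree_le e g" "hom_comp e g = hom_comp e f"
        using f by blast
      \<comment> \<open>A nonzero component in degree \<open>e\<close> makes the bound on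
        \<open>g\<close> sharp.\<close>
      have "total_degree g = e"
        using g False by (intro total_degree_eq) auto
      then have "hom_comp e f = degree_form g" "g \<noteq> 0"
        using g False by (auto simp: degree_form_eq_hom_comp)
      then show ?thesis
        using G g(1) by blast
    qed
    then have "(\<Sum>e\<le>total_degree f. hom_comp e f) \<in> degree_form_ideal I"
      by (intro ideal_sum_mem[OF D])
    then show ?thesis
      using mpoly_eq_sum_hom_comp[OF degree_le_total_degree[of f]] by simp
  qed
qed

lemma ideal_degree_form_ideal:
  fixes I :: "('x::finite, 'k::field) mpoly set"
  shows "ideal (degree_form_ideal I) poly_ring"
proof -
  interpret ring "poly_ring :: ('x, 'k) mpoly ring" by (rule ring_from_type_algebra)
  show ?thesis
    unfolding degree_form_ideal_def by (rule genideal_ideal) auto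
qed

text \<open>Here \<open>e\<close> is only an upper bound: if \<open>g\<close> has smaller degree,
  the component is 0.\<close>

lemma hom_comp_mem_degree_form_ideal:
  assumes I: "ideal I poly_ring" and g: "g \<in> I" "degree_le e g"
  shows "hom_comp e g \<in> degree_form_ideal I"
  unfolding degree_form_ideal_iff[OF I]
proof
  fix d
  show "\<exists>h\<in>I. degree_le d h \<and> hom_comp d h = hom_comp d (hom_comp e g)"
    using g ideal_zero_mem[OF I]
    by (cases "d = e") (auto simp: hom_comp_hom_comp intro: bexI[of _ 0])
qed

lemma degree_form_ideal_homogeneous:
  assumes I: "ideal I poly_ring" and f: "f \<in> degree_form_ideal I"
  shows "hom_comp e f \<in> degree_form_ideal I"
  using f hom_comp_mem_degree_form_ideal[OF I] unfolding degree_form_ideal_iff[OF I, of f]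
  by metis

text \<open>This says F_d R = R, in terms of representatives, so that I and DF(I) can be compared
  without dimensions.\<close>

definition degree_spanning :: "nat \<Rightarrow> ('x::finite, 'k::field) mpoly set \<Rightarrow> bool"
  where "degree_spanning d I \<longleftrightarrow> (\<forall>p. \<exists>q. degree_le d q \<and> p - q \<in> I)"

text \<open>Modulo \<open>I\<close> the term is congruent to some \<open>q\<close> of degree at most
  \<open>d\<close>, so the term itself is the top component of an element of
  \<open>I\<close>.\<close>

lemma single_mem_degree_form_ideal:
  assumes I: "ideal I poly_ring" and "degree_spanning d I" "d < monom_degree m"
  shows "Poly_Mapping.single m c \<in> degree_form_ideal I"
proof -
  let ?p = "Poly_Mapping.single m c"
  obtain q where q: "degree_le d q" "?p - q \<in> I"
    using assms(2) unfolding degree_spanning_def by blast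
  have "degree_le (monom_degree m) (?p - q)"
    using q assms(3) by (intro degree_le_diff) (auto intro: degree_le_single degree_le_mono)
  then have "hom_comp (monom_degree m) (?p - q) \<in> degree_form_ideal I"
    by (rule hom_comp_mem_degree_form_ideal[OF I q(2)])
  then show ?thesis
    using hom_comp_eq_0[OF q(1) assms(3)] by (simp add: hom_comp_diff hom_comp_single)
qed

text \<open>From \<open>I\<close> to DF(I), terms of degree above \<open>d\<close> lie in DF(I) and
  are dropped. Backwards, the degree of \<open>p\<close> is lowered one step at a time: its top
  component belongs to DF(I), hence is also that of some \<open>g\<close> in \<open>I\<close>, and
  \<open>g\<close> is subtracted.\<close>

lemma degree_spanning_degree_form_ideal:
  assumes I: "ideal I poly_ring" 
  shows "degree_spanning d (degree_form_ideal I) \<longleftrightarrow> degree_spanning d I"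
proof
  note D = ideal_degree_form_ideal[of I]
  assume *: "degree_spanning d I"
  have "\<exists>q. degree_le d q \<and> p - q \<in> degree_form_ideal I" for p
  proof (induction p rule: mpoly_induct)
    case zero
    show ?case using ideal_zero_mem[OF D] by (intro exI[of _ 0]) auto
  next
    case (add p q)
    then obtain p' q' where "degree_le d p'" "p - p' \<in> degree_form_ideal I"
      "degree_le d q'" "q - q' \<in> degree_form_ideal I" by blast
    then show ?case
      using ideal_add_mem[OF D, of "p - p'" "q - q'"]
      by (intro exI[of _ "p' + q'"]) (auto simp: degree_le_add algebra_simps)
  next
    case (single m c)
    show ?case
    proof (cases "monom_degree m \<le> d")
      case True
      then show ?thesis
        using ideal_zero_mem[OF D]
        by (intro exI[of _ "Poly_Mapping.single m c"]) (auto simp: degree_le_single)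
    next
      case False
      then show ?thesis
        using single_mem_degree_form_ideal[OF I *, of m c] by (intro exI[of _ 0]) auto
    qed
  qed
  then show "degree_spanning d (degree_form_ideal I)"
    by (simp add: degree_spanning_def)
next
  assume *: "degree_spanning d (degree_form_ideal I)"
  have "degree_le (d + n) p \<Longrightarrow> \<exists>q. degree_le d q \<and> p - q \<in> I" for n p
  proof (induction n arbitrary: p)
    case 0
    then show ?case
      using ideal_zero_mem[OF I] by (intro exI[of _ p]) auto
  next
    case (Suc n)
    \<comment> \<open>As \<open>q\<close> has degree at most \<open>d\<close>, the polynomials
      \<open>p\<close> and \<open>p - q\<close> agree in degree \<open>Suc (d + n)\<close>.\<close>
    obtain q where q: "degree_le d q" "p - q \<in> degree_form_ideal I"
      using * unfolding degree_spanning_def by blast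
    obtain g where g: "g \<in> I" "degree_le (Suc (d + n)) g"
      "hom_comp (Suc (d + n)) g = hom_comp (Suc (d + n)) (p - q)"
      using q(2) unfolding degree_form_ideal_iff[OF I] by blast
    have "hom_comp (Suc (d + n)) (p - g) = 0"
      using g(3) hom_comp_eq_0[OF q(1), of "Suc (d + n)"] by (simp add: hom_comp_diff)
    then have "degree_le (d + n) (p - g)"
      using Suc.prems g(2) by (subst degree_le_Suc_iff) (auto intro: degree_le_diff)
    from Suc.IH[OF this] obtain r where "degree_le d r" "p - g - r \<in> I" by blast
    then show ?case
      using ideal_add_mem[OF I _ g(1), of "p - g - r"] by (intro exI[of _ r]) auto
  qed
  moreover have "degree_le (d + total_degree p) p" for p
    by (rule degree_le_mono[OF degree_le_total_degree]) simp
  ultimately show "degree_spanning d I"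
    unfolding degree_spanning_def by blast
qed

section \<open>Dimension and regularity index\<close>

lemma carrier_quot_alg: "carrier (quot_alg I) = image_in I UNIV"
  by (auto simp: quot_alg_def FactRing_def A_RCOSETS_def' image_in_def)

lemma zero_quot_alg: "\<zero>\<^bsub>quot_alg I\<^esub> = I"
  by (simp add: quot_alg_def FactRing_def)

lemma ring_hom_ring_quot_alg:
  assumes "ideal I poly_ring"
  shows "ring_hom_ring poly_ring (quot_alg I) ((+>\<^bsub>poly_ring\<^esub>) I)"
  unfolding quot_alg_def by (rule ideal.rcos_ring_hom_ring[OF assms])

section \<open>The constants as coefficient field and dimensions over it\<close>

lemma const_poly_simps [simp]:
  "const_poly 0 = 0" "const_poly 1 = 1"
  "const_poly (a + b) = const_poly a + const_poly b"
  "const_poly (a * b) = const_poly a * const_poly b"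
  "const_poly (- a) = - const_poly a"
  by (simp_all add: const_poly_def single_add mult_single single_uminus)

lemma subfield_const_poly: "subfield (range const_poly) (poly_ring :: ('x::finite, 'k::field) mpoly ring)"
proof -
  interpret cring "poly_ring :: ('x, 'k) mpoly ring" by (rule cring_from_type_algebra)
  let ?K = "range const_poly :: ('x, 'k) mpoly set"
  have "subring ?K poly_ring"
  proof (rule subringI)
    show "\<one>\<^bsub>poly_ring\<^esub> \<in> ?K"
      by (metis const_poly_simps(2) rangeI ring_of_type_algebra_simps(4))
  qed (auto simp flip: const_poly_simps)
  moreover have "Units (poly_ring \<lparr>carrier := ?K\<rparr>) = ?K - {\<zero>\<^bsub>poly_ring\<^esub>}"
  proof (intro equalityI subsetI)
    fix u assume "u \<in> Units (poly_ring \<lparr>carrier := ?K\<rparr>)"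
    then show "u \<in> ?K - {\<zero>\<^bsub>poly_ring\<^esub>}"
      by (auto simp: Units_def)
  next
    fix u assume u: "u \<in> ?K - {\<zero>\<^bsub>poly_ring\<^esub>}"
    then obtain c where "u = const_poly c" by auto
    moreover from this u have "c \<noteq> 0" by auto
    ultimately show "u \<in> Units (poly_ring \<lparr>carrier := ?K\<rparr>)"
      by (auto simp: Units_def simp flip: const_poly_simps intro!: exI[of _ "inverse c"])
  qed
  ultimately show ?thesis
    by (intro subfieldI subcringI')
qed

lemma one_ne_zero_quot_alg:
  assumes "ideal I poly_ring" "1 \<notin> I"
  shows "\<one>\<^bsub>quot_alg I\<^esub> \<noteq> \<zero>\<^bsub>quot_alg I\<^esub>"
  using a_r_coset_eq_iff[OF assms(1), of 1 0] assms
  by (auto simp: quot_alg_def FactRing_def a_r_coset_ring_of_type_algebra)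

lemma subfield_base_field:
  assumes "ideal I poly_ring" "1 \<notin> I"
  shows "subfield (base_field I) (quot_alg I)"
  unfolding base_field_def image_in_def
  by (rule ring_hom_ring.img_is_subfield(2)[OF ring_hom_ring_quot_alg[OF assms(1)]
        subfield_const_poly one_ne_zero_quot_alg[OF assms]])

lemma kdim_eq:
  assumes "ideal I poly_ring" "1 \<notin> I" "ring.dimension (quot_alg I) n (base_field I) V"
  shows "kdim I V = n"
proof -
  interpret ring_hom_ring poly_ring "quot_alg I" "(+>\<^bsub>poly_ring\<^esub>) I"
    by (rule ring_hom_ring_quot_alg[OF assms(1)])
  show ?thesis
    using S.dimI[OF subfield_base_field[OF assms(1,2)] assms(3)] by (simp add: kdim_def over_def)
qed

text \<open>A \<open>subalgebra\<close> is an additive subgroup stable under scalars, that is, a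
  subspace; closure under products is not part of it.\<close>

lemma subalgebra_degree_le:
  "subalgebra (range const_poly) {p :: ('x::finite, 'k::field) mpoly. degree_le d p} poly_ring"
proof -
  interpret ring "poly_ring :: ('x, 'k) mpoly ring" by (rule ring_from_type_algebra)
  have "subgroup {p :: ('x, 'k) mpoly. degree_le d p} (add_monoid poly_ring)"
    by (rule add.subgroupI) (auto intro: degree_le_add exI[of _ 0])
  then show ?thesis
    by (auto simp: subalgebra_def subalgebra_axioms_def degree_le_const_poly_mult)
qed

text \<open>A finite generating list lifts to polynomials of bounded degree; conversely, there are
  only finitely many monomials of degree at most \<open>d\<close>, and their classes span.\<close>

lemma finite_dimension_quot_alg_iff:
  fixes I :: "('x::finite, 'k::field) mpoly set"
  assumes I: "ideal I poly_ring" "1 \<notin> I"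
  shows "ring.finite_dimension (quot_alg I) (base_field I) (carrier (quot_alg I)) \<longleftrightarrow>
    (\<exists>d. degree_spanning d I)"
proof -
  let ?h = "(+>\<^bsub>poly_ring\<^esub>) I" and ?K = "range const_poly :: ('x, 'k) mpoly set"
  interpret ring_hom_ring poly_ring "quot_alg I" ?h
    by (rule ring_hom_ring_quot_alg[OF I(1)])
  note K = subfield_const_poly[where ?'x = 'x and ?'k = 'k] and bK = subfield_base_field[OF I]
  have span: "S.Span (base_field I) (map ?h Us) = image_in I (R.Span ?K Us)" for Us
    unfolding base_field_def image_in_def by (rule Span_hom) auto
  show ?thesis
  proof
    assume "S.finite_dimension (base_field I) (carrier (quot_alg I))"
    then obtain Vs where Vs: "set Vs \<subseteq> carrier (quot_alg I)"
      "S.Span (base_field I) Vs = carrier (quot_alg I)"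
      using S.exists_base[OF bK] unfolding S.finite_dimension_def by blast
    then have "\<forall>v\<in>set Vs. \<exists>u. v = ?h u"
      by (auto simp: carrier_quot_alg image_in_def)
    then obtain Us where Us: "Vs = map ?h Us"
      unfolding ex_map_conv[symmetric] by blast
    \<comment> \<open>\<open>insert 0\<close> keeps the maximum defined for an empty list.\<close>
    define d where "d = Max (insert 0 (total_degree ` set Us))"
    have "total_degree u \<le> d" if "u \<in> set Us" for u
      unfolding d_def using that by (intro Max_ge) auto
    then have "set Us \<subseteq> {p. degree_le d p}"
      using degree_le_mono[OF degree_le_total_degree] by blast
    then have "R.Span ?K Us \<subseteq> {p. degree_le d p}"
      by (rule R.subalgebra_Span_incl[OF K subalgebra_degree_le])
    moreover have "\<exists>q\<in>R.Span ?K Us. p - q \<in> I" for p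
    proof -
      have "image_in I (R.Span ?K Us) = image_in I UNIV"
        using Vs(2) unfolding Us span carrier_quot_alg .
      then have "?h p \<in> image_in I (R.Span ?K Us)"
        by (simp only: image_in_def UNIV_I imageI)
      then obtain q where q: "q \<in> R.Span ?K Us" "?h p = ?h q"
        unfolding image_in_def by (rule imageE)
      from q(2) have "p - q \<in> I"
        by (simp only: a_r_coset_eq_iff[OF I(1)])
      with q(1) show ?thesis ..
    qed
    ultimately have "degree_spanning d I"
      unfolding degree_spanning_def by fast
    then show "\<exists>d. degree_spanning d I" by blast
  next
    assume "\<exists>d. degree_spanning d I"
    then obtain d where d: "degree_spanning d I" by blast
    obtain ms where ms: "set ms = {m :: 'x \<Rightarrow>\<^sub>0 nat. monom_degree m \<le> d}"
      using finite_list[OF finite_monom_degree_le] by blast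
    define Us :: "('x, 'k) mpoly list" where "Us = map (\<lambda>m. Poly_Mapping.single m 1) ms"
    have Us: "set Us \<subseteq> carrier poly_ring" by simp
    interpret Sp: subalgebra ?K "R.Span ?K Us" poly_ring
      by (rule R.Span_is_subalgebra[OF K Us])
    have single: "Poly_Mapping.single m c \<in> R.Span ?K Us" if "monom_degree m \<le> d" for m c
    proof -
      have "Poly_Mapping.single m 1 \<in> R.Span ?K Us"
        using that R.Span_base_incl[OF K Us] by (auto simp: Us_def ms)
      then have "const_poly c * Poly_Mapping.single m 1 \<in> R.Span ?K Us"
        using Sp.smult_closed[of "const_poly c" "Poly_Mapping.single m 1"] by simp
      then show ?thesis
        by (simp add: const_poly_def mult_single)
    qed
    \<comment> \<open>\<open>Sp.one_closed\<close> and \<open>Sp.m_closed\<close> refer to the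
      additive monoid: they are closure under 0 and under addition.\<close>
    have sum: "sum f A \<in> R.Span ?K Us" if "\<And>x. x \<in> A \<Longrightarrow> f x \<in> R.Span ?K Us"
      for A and f :: "('x \<Rightarrow>\<^sub>0 nat) \<Rightarrow> ('x, 'k) mpoly"
      using that
      by (induction A rule: infinite_finite_induct)
        (use Sp.one_closed Sp.m_closed in \<open>auto simp del: R.Span.simps\<close>)
    have le: "q \<in> R.Span ?K Us" if "degree_le d q" for q
      by (subst mpoly_eq_sum_single, rule sum, rule single) (use that in \<open>auto simp: degree_le_def\<close>)
    have "image_in I (R.Span ?K Us) = carrier (quot_alg I)"
      unfolding carrier_quot_alg
    proof (intro equalityI subsetI)
      fix P assume "P \<in> image_in I UNIV"
      then obtain p where p: "P = ?h p" by (auto simp: image_in_def)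
      obtain q where q: "degree_le d q" "p - q \<in> I"
        using d unfolding degree_spanning_def by blast
      then have "P = ?h q"
        using a_r_coset_eq_iff[OF I(1)] p by blast
      then show "P \<in> image_in I (R.Span ?K Us)"
        using le[OF q(1)] unfolding image_in_def by blast
    qed (auto simp: image_in_def simp del: R.Span.simps)
    then show "S.finite_dimension (base_field I) (carrier (quot_alg I))"
      using S.Span_finite_dimension[OF bK, of "map ?h Us"] unfolding span
      by (auto simp: carrier_quot_alg image_in_def simp del: R.Span.simps)
  qed
qed

lemma zero_dimensional_iff:
  "zero_dimensional I \<longleftrightarrow> ideal I poly_ring \<and> 1 \<notin> I \<and> (\<exists>d. degree_spanning d I)"
  unfolding zero_dimensional_def
  using finite_dimension_quot_alg_iff[of I] ideal_ne_carrier_iff[of I] by auto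

lemma zero_dimensionalD:
  assumes "zero_dimensional I"
  shows "ideal I poly_ring" "1 \<notin> I"
  using assms by (auto simp: zero_dimensional_iff)

text \<open>Dimension 0 would force 1 = 0 in the quotient. This excludes negative regularity indices
  and divisors equal to \<open>I\<close>.\<close>

lemma kdim_carrier_ne_0:
  assumes "zero_dimensional I"
  shows "kdim I (carrier (quot_alg I)) \<noteq> 0"
proof
  note I = zero_dimensionalD[OF assms]
  interpret ring_hom_ring poly_ring "quot_alg I" "(+>\<^bsub>poly_ring\<^esub>) I"
    by (rule ring_hom_ring_quot_alg[OF I(1)])
  assume 0: "kdim I (carrier (quot_alg I)) = 0"
  obtain n where n: "S.dimension n (base_field I) (carrier (quot_alg I))"
    using assms by (auto simp: zero_dimensional_def S.finite_dimension_def)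
  have "n = 0"
    using kdim_eq[OF I n] 0 by simp
  then have "carrier (quot_alg I) = {\<zero>\<^bsub>quot_alg I\<^esub>}"
    using S.dimension_zero[OF subfield_base_field[OF I]] n by blast
  then show False
    using one_ne_zero_quot_alg[OF I] S.one_closed by blast
qed

lemma kdim_zero:
  assumes "ideal I poly_ring" "1 \<notin> I"
  shows "kdim I {I} = 0"
proof -
  interpret ring_hom_ring poly_ring "quot_alg I" "(+>\<^bsub>poly_ring\<^esub>) I"
    by (rule ring_hom_ring_quot_alg[OF assms(1)])
  show ?thesis
    using kdim_eq[OF assms S.dimension.zero_dim] by (simp add: zero_quot_alg)
qed

lemma filt_quot_of_nat_eq_carrier_iff:
  fixes I :: "('x::finite, 'k::field) mpoly set"
  assumes I: "ideal I poly_ring"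
  shows "filt_quot I (int d) = carrier (quot_alg I) \<longleftrightarrow> degree_spanning d I"
proof -
  have "filt_quot I (int d) \<subseteq> carrier (quot_alg I)"
    by (auto simp: filt_quot_def carrier_quot_alg image_in_def)
  moreover have "carrier (quot_alg I) \<subseteq> filt_quot I (int d) \<longleftrightarrow>
      (\<forall>p. \<exists>q. degree_le d q \<and> I +>\<^bsub>poly_ring\<^esub> p = I +>\<^bsub>poly_ring\<^esub> q)"
    unfolding filt_quot_def carrier_quot_alg image_in_def filt_poly_of_nat by blast
  ultimately show ?thesis
    unfolding degree_spanning_def a_r_coset_eq_iff[OF I] by blast
qed

text \<open>A subspace of full finite dimension is everything: a basis of it is an independent list
  of maximal length, hence spans the quotient.\<close>

lemma affine_HF_eq_kdim_carrier_iff: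
  assumes "zero_dimensional I"
  shows "affine_HF I (int d) = kdim I (carrier (quot_alg I)) \<longleftrightarrow> degree_spanning d I"
proof
  assume "degree_spanning d I"
  then have "filt_quot I (int d) = carrier (quot_alg I)"
    using filt_quot_of_nat_eq_carrier_iff[OF zero_dimensionalD(1)[OF assms]] by blast
  then show "affine_HF I (int d) = kdim I (carrier (quot_alg I))"
    by (simp add: affine_HF_def)
next
  note I = zero_dimensionalD[OF assms]
  let ?h = "(+>\<^bsub>poly_ring\<^esub>) I"
  interpret ring_hom_ring poly_ring "quot_alg I" ?h
    by (rule ring_hom_ring_quot_alg[OF I(1)])
  note bK = subfield_base_field[OF I]
  assume eq: "affine_HF I (int d) = kdim I (carrier (quot_alg I))"
  obtain n where n: "S.dimension n (base_field I) (carrier (quot_alg I))"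
    using assms by (auto simp: zero_dimensional_def S.finite_dimension_def)
  have "subalgebra (base_field I) (filt_quot I (int d)) (quot_alg I)"
    unfolding filt_quot_def filt_poly_of_nat base_field_def image_in_def
    by (rule img_is_subalgebra[OF _ subalgebra_degree_le]) simp
  moreover have sub: "filt_quot I (int d) \<subseteq> carrier (quot_alg I)"
    by (auto simp: filt_quot_def carrier_quot_alg image_in_def)
  ultimately have "S.finite_dimension (base_field I) (filt_quot I (int d))"
    using S.subalbegra_incl_imp_finite_dimension[OF bK S.finite_dimensionI[OF n]] by blast
  then obtain m where m: "S.dimension m (base_field I) (filt_quot I (int d))"
    by blast
  have "m = n"
    using eq kdim_eq[OF I m] kdim_eq[OF I n] by (simp add: affine_HF_def)
  obtain Us where Us: "S.independent (base_field I) Us" "length Us = m"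
    "S.Span (base_field I) Us = filt_quot I (int d)" "set Us \<subseteq> carrier (quot_alg I)"
    using S.exists_base[OF bK m] by blast
  then have "filt_quot I (int d) = carrier (quot_alg I)"
    using S.independent_length_eq_dimension[OF bK n Us(1,4)] \<open>m = n\<close> by blast
  then show "degree_spanning d I"
    using filt_quot_of_nat_eq_carrier_iff[OF I(1)] by blast
qed

section \<open>The regularity index as least spanning degree\<close>

lemma degree_spanning_mono: "degree_spanning d I \<Longrightarrow> d \<le> e \<Longrightarrow> degree_spanning e I"
  unfolding degree_spanning_def using degree_le_mono by blast

text \<open>\<open>LEAST\<close> over the integers is justified because the Hilbert function is 0 at
  negative arguments while the quotient has positive dimension.\<close>

lemma reg_index_eq:
  assumes "zero_dimensional I"
  shows "reg_index I = int (LEAST d. degree_spanning d I)"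
proof -
  note I = zero_dimensionalD[OF assms]
  let ?d = "LEAST d. degree_spanning d I"
  have d: "degree_spanning ?d I"
    using assms LeastI_ex[of "\<lambda>d. degree_spanning d I"] by (auto simp: zero_dimensional_iff)
  show ?thesis
    unfolding reg_index_def
  proof (rule Least_equality, intro allI impI)
    fix j assume "int ?d \<le> j"
    then obtain e where "j = int e" "?d \<le> e"
      by (metis nat_le_iff nonneg_int_cases of_nat_0_le_iff order_trans nat_int)
    then show "affine_HF I j = kdim I (carrier (quot_alg I))"
      using affine_HF_eq_kdim_carrier_iff[OF assms] degree_spanning_mono[OF d] by blast
  next
    fix i assume i: "\<forall>j\<ge>i. affine_HF I j = kdim I (carrier (quot_alg I))"
    show "int ?d \<le> i"
    proof (cases "0 \<le> i")
      case True
      then obtain e where e: "i = int e"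
        by (metis nonneg_int_cases)
      then have "degree_spanning e I"
        using i affine_HF_eq_kdim_carrier_iff[OF assms] by blast
      then show ?thesis
        using e by (simp add: Least_le)
    next
      case False
      then have "filt_quot I i = {I}"
        using a_r_coset_zero[OF I(1)] ideal_zero_mem[OF I(1)]
        by (simp add: filt_quot_def filt_poly_neg image_in_def)
      then have "affine_HF I i = 0"
        using kdim_zero[OF I] by (simp add: affine_HF_def)
      then show ?thesis
        using i kdim_carrier_ne_0[OF assms] by simp
    qed
  qed
qed

section \<open>Orders of residue classes\<close>

lemma coset_mem_filt_quot_iff:
  assumes I: "ideal I poly_ring"
  shows "I +>\<^bsub>poly_ring\<^esub> p \<in> filt_quot I i \<longleftrightarrow> (\<exists>q\<in>filt_poly i. p - q \<in> I)"
  by (simp add: filt_quot_def image_in_def image_iff a_r_coset_eq_iff[OF I])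

text \<open>A version of \<open>filt_ord\<close> on representatives with natural values. On
  \<open>I\<close> it is 0, whereas the zero class lies in every filtration step and has no least
  index.\<close>

definition ord_mod :: "('x::finite, 'k::field) mpoly set \<Rightarrow> ('x, 'k) mpoly \<Rightarrow> nat"
  where "ord_mod I p = (LEAST d. \<exists>q. degree_le d q \<and> p - q \<in> I)"

lemma ord_mod_le: "degree_le d q \<Longrightarrow> p - q \<in> I \<Longrightarrow> ord_mod I p \<le> d"
  unfolding ord_mod_def by (rule Least_le) blast

lemma ord_mod_witness:
  assumes "ideal I poly_ring"
  obtains q where "degree_le (ord_mod I p) q" "p - q \<in> I"
proof -
  have "\<exists>q. degree_le (total_degree p) q \<and> p - q \<in> I"
    using degree_le_total_degree[of p] ideal_zero_mem[OF assms] by (intro exI[of _ p]) auto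
  then have "\<exists>q. degree_le (ord_mod I p) q \<and> p - q \<in> I"
    unfolding ord_mod_def by (rule LeastI)
  then show thesis using that by blast
qed

text \<open>Scalars do not raise the order. Applied in both directions, this shows that all nonzero
  elements of a line have the same order.\<close>

lemma ord_mod_le_if_diff_mem:
  assumes I: "ideal I poly_ring" and "p - const_poly c * q \<in> I"
  shows "ord_mod I p \<le> ord_mod I q"
proof -
  obtain r where r: "degree_le (ord_mod I q) r" "q - r \<in> I"
    by (rule ord_mod_witness[OF I])
  have "(p - const_poly c * q) + const_poly c * (q - r) \<in> I"
    using assms r by (intro ideal_add_mem[OF I] ideal_mult_mem[OF I])
  then have "p - const_poly c * r \<in> I"
    by (simp add: algebra_simps)
  then show ?thesis
    by (rule ord_mod_le[OF degree_le_const_poly_mult[OF r(1)]])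
qed

lemma filt_ord_coset:
  assumes I: "ideal I poly_ring" and p: "p \<notin> I"
  shows "filt_ord I (I +>\<^bsub>poly_ring\<^esub> p) = int (ord_mod I p)"
  unfolding filt_ord_def coset_mem_filt_quot_iff[OF I]
proof (rule Least_equality)
  show "\<exists>q\<in>filt_poly (int (ord_mod I p)). p - q \<in> I"
    unfolding filt_poly_of_nat using ord_mod_witness[OF I, of p] by blast
next
  fix i assume i: "\<exists>q\<in>filt_poly i. p - q \<in> I"
  show "int (ord_mod I p) \<le> i"
  proof (cases "0 \<le> i")
    case True
    then obtain d where "i = int d" by (metis nonneg_int_cases)
    then show ?thesis
      using i ord_mod_le[of d _ p I] by (auto simp: filt_poly_of_nat)
  next
    case False
    then show ?thesis
      using i p by (simp add: filt_poly_neg)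
  qed
qed

lemma reg_index_ideal_image_in:
  assumes I: "ideal I poly_ring"
  shows "reg_index_ideal I (image_in I J) = Max ((\<lambda>p. int (ord_mod I p)) ` (J - I))"
proof -
  have "{filt_ord I f | f. f \<in> image_in I J \<and> f \<noteq> \<zero>\<^bsub>quot_alg I\<^esub>} =
      (\<lambda>p. filt_ord I (I +>\<^bsub>poly_ring\<^esub> p)) ` (J - I)"
    using a_r_coset_zero[OF I] by (auto simp: image_in_def zero_quot_alg)
  also have "\<dots> = (\<lambda>p. int (ord_mod I p)) ` (J - I)"
    by (rule image_cong) (auto simp: filt_ord_coset[OF I])
  finally show ?thesis
    by (simp add: reg_index_ideal_def)
qed

section \<open>The socle of the associated graded ring\<close>

text \<open>The constant coefficient is evaluation at the origin; exponents add up to 0 only if both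
  are 0.\<close>

lemma lookup_mult_0:
  fixes p q :: "('x \<Rightarrow>\<^sub>0 nat) \<Rightarrow>\<^sub>0 'k::comm_ring_1"
  shows "Poly_Mapping.lookup (p * q) 0 = Poly_Mapping.lookup p 0 * Poly_Mapping.lookup q 0"
proof (induction p rule: mpoly_induct)
  case (single m c)
  show ?case
  proof (induction q rule: mpoly_induct)
    case (single m' c')
    have "m + m' = 0 \<longleftrightarrow> m = 0 \<and> m' = 0"
      by (auto simp: poly_mapping_eq_iff fun_eq_iff lookup_add)
    then show ?case
      by (auto simp: mult_single lookup_single when_def)
  qed (auto simp: distrib_left lookup_add)
qed (auto simp: distrib_right lookup_add)

lemma lookup_power_0:
  fixes p :: "('x \<Rightarrow>\<^sub>0 nat) \<Rightarrow>\<^sub>0 'k::comm_ring_1"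
  shows "Poly_Mapping.lookup (p ^ n) 0 = Poly_Mapping.lookup p 0 ^ n"
  by (induction n) (simp_all add: lookup_mult_0)

lemma lookup_const_poly_0 [simp]: "Poly_Mapping.lookup (const_poly c) 0 = c"
  by (simp add: const_poly_def)

text \<open>For an ideal between a power of the homogeneous maximal ideal and that maximal ideal,
  such as \<open>degree_form_ideal I\<close>, the trivial decomposition is primary, and each socle element
  spans a minimal divisor modulo it.\<close>

context
  fixes Q :: "('x::finite, 'k::field) mpoly set" and d :: nat
  assumes Q: "ideal Q poly_ring"
    and Q_lookup_0: "\<And>q. q \<in> Q \<Longrightarrow> Poly_Mapping.lookup q 0 = 0"
    and Q_single: "\<And>m c. d < monom_degree m \<Longrightarrow> Poly_Mapping.single m c \<in> Q"
begin

text \<open>Without constant term, all terms of the power have degree at least \<open>Suc d\<close>,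
  and such terms lie in \<open>Q\<close>.\<close>

lemma power_mem_if_lookup_0:
  assumes "Poly_Mapping.lookup p 0 = 0"
  shows "p ^ Suc d \<in> Q"
proof -
  have "monom_degree m \<noteq> 0" if "m \<in> Poly_Mapping.keys p" for m
    using assms that by (auto simp: in_keys_iff)
  then have "degree_ge 1 p"
    unfolding degree_ge_def by (metis One_nat_def Suc_leI neq0_conv)
  then have "degree_ge (Suc d) (p ^ Suc d)"
    by (rule degree_ge_power)
  then have "(\<Sum>m\<in>Poly_Mapping.keys (p ^ Suc d).
      Poly_Mapping.single m (Poly_Mapping.lookup (p ^ Suc d) m)) \<in> Q"
    by (intro ideal_sum_mem[OF Q] Q_single) (auto simp: degree_ge_def)
  then show ?thesis
    unfolding mpoly_eq_sum_single[symmetric] .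
qed

lemma radical_eq_lookup_0: "radical poly_ring Q = {p. Poly_Mapping.lookup p 0 = 0}"
proof (intro equalityI subsetI)
  fix p assume "p \<in> radical poly_ring Q"
  then obtain n where "p ^ n \<in> Q" by (auto simp: radical_def)
  then have "Poly_Mapping.lookup p 0 ^ n = 0"
    using Q_lookup_0 lookup_power_0 by metis
  then show "p \<in> {p. Poly_Mapping.lookup p 0 = 0}" by simp
next
  fix p :: "('x, 'k) mpoly" assume "p \<in> {p. Poly_Mapping.lookup p 0 = 0}"
  then have "p ^ Suc d \<in> Q" by (intro power_mem_if_lookup_0) simp
  then show "p \<in> radical poly_ring Q"
    unfolding radical_def by (auto simp del: power_Suc)
qed

text \<open>If \<open>b\<close> has a nonzero constant coefficient, it is a unit modulo
  \<open>Q\<close>: scaling it to constant coefficient 1 leaves \<open>u = 1 - v * b\<close>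
  nilpotent. From \<open>a * b\<close> in \<open>Q\<close> follows that \<open>a\<close> is
  congruent to \<open>a * u ^ k\<close> for every \<open>k\<close>, hence to 0.\<close>

lemma primary_ideal_Q: "primary_ideal Q poly_ring"
  unfolding primary_ideal_def
proof (intro conjI ballI impI Q)
  show "Q \<noteq> carrier poly_ring"
    using Q_lookup_0[of 1] by auto
next
  fix a b
  assume "a \<otimes>\<^bsub>poly_ring\<^esub> b \<in> Q"
  then have ab: "a * b \<in> Q" by simp
  show "a \<in> Q \<or> b \<in> radical poly_ring Q"
  proof (cases "Poly_Mapping.lookup b 0 = 0")
    case True
    then show ?thesis by (simp add: radical_eq_lookup_0)
  next
    case False
    define v :: "('x, 'k) mpoly" where "v = const_poly (inverse (Poly_Mapping.lookup b 0))"
    define u where "u = 1 - v * b"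
    have "Poly_Mapping.lookup u 0 = 0"
      using False by (simp add: u_def v_def lookup_minus lookup_mult_0)
    then have u: "a * u ^ Suc d \<in> Q"
      by (intro ideal_mult_mem[OF Q] power_mem_if_lookup_0)
    have "a - a * u ^ k \<in> Q" for k
    proof (induction k)
      case 0
      show ?case using ideal_zero_mem[OF Q] by simp
    next
      case (Suc k)
      have eq: "a - a * u ^ Suc k = (a - a * u ^ k) + (v * u ^ k) * (a * b)"
        by (simp add: u_def algebra_simps)
      show ?case
        unfolding eq by (rule ideal_add_mem[OF Q Suc ideal_mult_mem[OF Q ab]])
    qed
    from ideal_add_mem[OF Q this[of "Suc d"] u] show ?thesis by simp
  qed
qed

text \<open>Irredundancy holds since dropping the only component leaves the empty intersection, the
  whole ring.\<close>

lemma primary_decomposition_Q: "primary_decomposition poly_ring Q {Q}"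
  using primary_ideal_Q by (auto simp: primary_decomposition_def primary_ideal_def)

text \<open>Modulo the radical each polynomial equals its constant coefficient. The value 1 is the
  dimension required of minimal divisors.\<close>

lemma kdim_radical: "kdim (radical poly_ring Q) (carrier (quot_alg (radical poly_ring Q))) = 1"
proof -
  let ?M = "radical poly_ring Q"
  have M: "ideal ?M poly_ring"
    by (rule ideal_radical[OF Q])
  have one: "1 \<notin> ?M"
    by (simp add: radical_eq_lookup_0)
  interpret ring_hom_ring poly_ring "quot_alg ?M" "(+>\<^bsub>poly_ring\<^esub>) ?M"
    by (rule ring_hom_ring_quot_alg[OF M])
  have "?M +>\<^bsub>poly_ring\<^esub> p = ?M +>\<^bsub>poly_ring\<^esub> const_poly (Poly_Mapping.lookup p 0)" for p
    unfolding a_r_coset_eq_iff[OF M] by (simp add: radical_eq_lookup_0 lookup_minus)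
  then have "carrier (quot_alg ?M) = base_field ?M"
    unfolding carrier_quot_alg base_field_def image_in_def by blast
  then show ?thesis
    using kdim_eq[OF M one S.dimension_one[OF subfield_base_field[OF M one]]] by simp
qed

text \<open>If all indeterminates kill \<open>f\<close> modulo \<open>Q\<close>, then P acts on the
  class of \<open>f\<close> through evaluation at the origin.\<close>

lemma mult_socle:
  assumes f: "\<And>x. Poly_Mapping.single (Poly_Mapping.single x 1) 1 * f \<in> Q"
  shows "p * f - const_poly (Poly_Mapping.lookup p 0) * f \<in> Q"
proof (induction p rule: mpoly_induct)
  case zero
  show ?case using ideal_zero_mem[OF Q] by simp
next
  case (add p q)
  from ideal_add_mem[OF Q this] show ?case
    by (simp add: lookup_add algebra_simps)
next
  case (single m c)
  show ?case
  proof (cases "m = 0")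
    case True
    then show ?thesis using ideal_zero_mem[OF Q] by (simp add: const_poly_def)
  next
    case False
    then obtain x where x: "Poly_Mapping.lookup m x \<noteq> 0"
      by (auto simp: poly_mapping_eq_iff fun_eq_iff)
    let ?x = "Poly_Mapping.single x 1"
    \<comment> \<open>The subtraction is truncated, so this needs \<open>x\<close> to occur in
      \<open>m\<close>.\<close>
    have "m - ?x + ?x = m"
      by (rule poly_mapping_eqI) (use x in \<open>auto simp: lookup_add lookup_minus lookup_single when_def\<close>)
    then have "Poly_Mapping.single m c = Poly_Mapping.single (m - ?x) c * Poly_Mapping.single ?x 1"
      by (simp add: mult_single)
    then have "Poly_Mapping.single m c * f \<in> Q"
      using ideal_mult_mem[OF Q f[of x]] by (simp add: mult.assoc)
    then show ?thesis
      using False by (simp add: lookup_single)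
  qed
qed

text \<open>The socle element spans a line modulo \<open>Q\<close> that is already an ideal, hence a
  minimal divisor. Its nonzero elements all have the order of \<open>f\<close>, so the maximum in
  \<open>reg_index_ideal\<close> is that order.\<close>

lemma CBP_imp_ord_socle:
  assumes CBP: "CBP Q" and f: "f \<notin> Q"
    and socle: "\<And>x. Poly_Mapping.single (Poly_Mapping.single x 1) 1 * f \<in> Q"
  shows "reg_index Q = int (ord_mod Q f)"
proof -
  let ?h = "(+>\<^bsub>poly_ring\<^esub>) Q"
  interpret ring_hom_ring poly_ring "quot_alg Q" ?h
    by (rule ring_hom_ring_quot_alg[OF Q])
  have one: "1 \<notin> Q" using Q_lookup_0[of 1] by auto
  \<comment> \<open>This is Q + Kf.\<close>
  define J where "J = {g. \<exists>c. g - const_poly c * f \<in> Q}"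
  have J: "ideal J poly_ring"
    unfolding ideal_ring_of_type_algebra_iff
  proof (intro conjI ballI allI)
    show "0 \<in> J"
      using ideal_zero_mem[OF Q] by (auto simp: J_def intro!: exI[of _ 0])
    show "a + b \<in> J" if "a \<in> J" "b \<in> J" for a b
    proof -
      obtain c c' where "a - const_poly c * f \<in> Q" "b - const_poly c' * f \<in> Q"
        using \<open>a \<in> J\<close> \<open>b \<in> J\<close> by (auto simp: J_def)
      from ideal_add_mem[OF Q this] show ?thesis
        by (auto simp: J_def algebra_simps intro!: exI[of _ "c + c'"])
    qed
    show "r * a \<in> J" if "a \<in> J" for r a
    proof -
      obtain c where c: "a - const_poly c * f \<in> Q"
        using \<open>a \<in> J\<close> by (auto simp: J_def)
      let ?r = "Poly_Mapping.lookup r 0"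
      have "r * a - const_poly (c * ?r) * f =
          r * (a - const_poly c * f) + const_poly c * (r * f - const_poly ?r * f)"
        by (simp add: algebra_simps)
      also have "\<dots> \<in> Q"
        by (intro ideal_add_mem[OF Q] ideal_mult_mem[OF Q] c mult_socle socle)
      finally show ?thesis unfolding J_def by blast
    qed
  qed
  have "Q \<subseteq> J"
    by (auto simp: J_def intro!: exI[of _ 0])
  moreover have fJ: "f \<in> J"
    using ideal_zero_mem[OF Q] by (auto simp: J_def intro!: exI[of _ 1])
  ultimately have "Q_divisor {Q} Q J"
    unfolding Q_divisor_def using J f by (intro exI[of _ J]) auto
  moreover have "kdim Q (image_in Q J) = 1"
  proof -
    \<comment> \<open>Written as a one-step extension of the zero space, the line gets dimension 1
      directly from the inductive rules for \<open>S.dimension\<close>.\<close>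
    have "image_in Q J = S.line_extension (base_field Q) (?h f) {\<zero>\<^bsub>quot_alg Q\<^esub>}"
    proof (rule Set.set_eqI)
      fix P
      have "P \<in> image_in Q J \<longleftrightarrow> (\<exists>c. P = ?h (const_poly c * f))"
      proof
        assume "P \<in> image_in Q J"
        then obtain g c where "P = ?h g" "g - const_poly c * f \<in> Q"
          by (auto simp: image_in_def J_def)
        then show "\<exists>c. P = ?h (const_poly c * f)"
          using a_r_coset_eq_iff[OF Q] by blast
      next
        assume "\<exists>c. P = ?h (const_poly c * f)"
        then show "P \<in> image_in Q J"
          using ideal_mult_mem[OF J fJ] by (auto simp: image_in_def)
      qed
      also have "\<dots> \<longleftrightarrow> (\<exists>c. P = ?h (const_poly c) \<otimes>\<^bsub>quot_alg Q\<^esub> ?h f)"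
        using hom_mult[of "const_poly _" f] by simp
      also have "\<dots> \<longleftrightarrow> P \<in> S.line_extension (base_field Q) (?h f) {\<zero>\<^bsub>quot_alg Q\<^esub>}"
      proof -
        have "?h (const_poly c) \<otimes>\<^bsub>quot_alg Q\<^esub> ?h f \<oplus>\<^bsub>quot_alg Q\<^esub> \<zero>\<^bsub>quot_alg Q\<^esub> =
            ?h (const_poly c) \<otimes>\<^bsub>quot_alg Q\<^esub> ?h f" for c
          by (intro S.r_zero S.m_closed hom_closed) auto
        then show ?thesis
          unfolding S.line_extension_mem_iff base_field_def image_in_def by auto
      qed
      finally show "P \<in> image_in Q J \<longleftrightarrow>
        P \<in> S.line_extension (base_field Q) (?h f) {\<zero>\<^bsub>quot_alg Q\<^esub>}" .
    qed
    moreover have "?h f \<notin> {\<zero>\<^bsub>quot_alg Q\<^esub>}"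
      using a_r_coset_zero[OF Q] f by (simp add: zero_quot_alg)
    moreover have "?h f \<in> carrier (quot_alg Q)"
      by (intro hom_closed) simp
    ultimately have "S.dimension (Suc 0) (base_field Q) (image_in Q J)"
      using S.dimension.Suc_dim[OF _ _ S.dimension.zero_dim] by simp
    then show ?thesis
      using kdim_eq[OF Q one] by simp
  qed
  ultimately have "minimal_Q_divisor Q {Q} Q J"
    by (simp add: minimal_Q_divisor_def kdim_radical)
  then have ri: "reg_index_ideal Q (image_in Q J) = reg_index Q"
    using CBP primary_decomposition_Q by (auto simp: CBP_def)
  have ord_eq: "ord_mod Q g = ord_mod Q f" if g: "g \<in> J - Q" for g
  proof -
    obtain c where c: "g - const_poly c * f \<in> Q"
      using g by (auto simp: J_def)
    \<comment> \<open>Otherwise \<open>g\<close> would be in \<open>Q\<close>.\<close>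
    have "c \<noteq> 0" using c g by auto
    then have "const_poly (inverse c) * const_poly c = (1 :: ('x, 'k) mpoly)"
      by (metis const_poly_simps(2,4) left_inverse)
    then have "f - const_poly (inverse c) * g = - const_poly (inverse c) * (g - const_poly c * f)"
      by (simp add: right_diff_distrib mult.assoc[symmetric])
    then have "f - const_poly (inverse c) * g \<in> Q"
      using ideal_mult_mem[OF Q c] by metis
    then show ?thesis
      using ord_mod_le_if_diff_mem[OF Q] c by (intro antisym)
  qed
  have "(\<lambda>p. int (ord_mod Q p)) ` (J - Q) = (\<lambda>_. int (ord_mod Q f)) ` (J - Q)"
    by (intro image_cong refl arg_cong[of _ _ int] ord_eq)
  also have "\<dots> = {int (ord_mod Q f)}"
    using f fJ by auto
  finally show ?thesis
    using ri by (simp add: reg_index_ideal_image_in[OF Q])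
qed

end

section \<open>Transfer from the associated graded ring to P/I\<close>

lemma degree_le_0_iff: "degree_le 0 p \<longleftrightarrow> p = const_poly (Poly_Mapping.lookup p 0)"
proof
  assume p: "degree_le 0 p"
  show "p = const_poly (Poly_Mapping.lookup p 0)"
  proof (rule poly_mapping_eqI)
    fix m
    show "Poly_Mapping.lookup p m = Poly_Mapping.lookup (const_poly (Poly_Mapping.lookup p 0)) m"
      using p by (cases "m = 0") (auto simp: const_poly_def lookup_single degree_le_def in_keys_iff)
  qed
qed (metis degree_le_const_poly)

text \<open>A nonzero component in degree 0 would come from a nonzero constant in \<open>I\<close>,
  a unit. So DF(I) vanishes at the origin for every proper \<open>I\<close>.\<close>

lemma lookup_0_degree_form_ideal:
  assumes I: "ideal I poly_ring" "1 \<notin> I" and f: "f \<in> degree_form_ideal I"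
  shows "Poly_Mapping.lookup f 0 = 0"
proof (rule ccontr)
  obtain g where g: "g \<in> I" "degree_le 0 g" "hom_comp 0 g = hom_comp 0 f"
    using f unfolding degree_form_ideal_iff[OF I(1)] by blast
  have "Poly_Mapping.lookup g 0 = Poly_Mapping.lookup f 0"
    using g(3) by (metis lookup_hom_comp monom_degree_zero)
  moreover assume "Poly_Mapping.lookup f 0 \<noteq> 0"
  ultimately have "const_poly (inverse (Poly_Mapping.lookup f 0)) * g = 1"
    using g(2) unfolding degree_le_0_iff by (metis const_poly_simps(2,4) left_inverse)
  then show False
    using ideal_mult_mem[OF I(1) g(1)] I(2) by metis
qed

lemma zero_dimensional_degree_form_ideal:
  assumes "zero_dimensional I"
  shows "zero_dimensional (degree_form_ideal I)"
  using assms lookup_0_degree_form_ideal[of I 1] ideal_degree_form_ideal[of I]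
  by (auto simp: zero_dimensional_iff degree_spanning_degree_form_ideal)

lemma reg_index_degree_form_ideal:
  assumes "zero_dimensional I"
  shows "reg_index (degree_form_ideal I) = reg_index I"
  using reg_index_eq[OF assms] reg_index_eq[OF zero_dimensional_degree_form_ideal[OF assms]]
    degree_spanning_degree_form_ideal[OF zero_dimensionalD(1)[OF assms]] by simp

lemma strict_CBP_imp_reg_index_ideal:
  assumes zd: "zero_dimensional I" and CBP: "strict_CBP I"
    and J: "ideal J poly_ring" "I \<subset> J"
  shows "reg_index_ideal I (image_in I J) = reg_index I"
proof -
  note I = zero_dimensionalD[OF zd]
  obtain d where d: "degree_spanning d I"
    using zd by (auto simp: zero_dimensional_iff)
  \<comment> \<open>A spanning degree bounds all orders, which makes the maximum below
    meaningful.\<close>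
  have "ord_mod I p \<le> d" for p
    using d ord_mod_le unfolding degree_spanning_def by blast
  then have fin: "finite (ord_mod I ` (J - I))"
    by (auto intro: finite_subset[OF _ finite_atMost[of d]])
  define e where "e = Max (ord_mod I ` (J - I))"
  have ne: "ord_mod I ` (J - I) \<noteq> {}"
    using J(2) by auto
  obtain f' where f': "f' \<in> J - I" "ord_mod I f' = e"
    using Max_in[OF fin ne] unfolding e_def by auto
  \<comment> \<open>A representative of lowest degree; it stays in \<open>J\<close> because
    \<open>I\<close> is contained in \<open>J\<close>.\<close>
  obtain f where f: "degree_le e f" "f' - f \<in> I"
    using ord_mod_witness[OF I(1), of f'] f'(2) by blast
  have "f' \<in> J" "f' - f \<in> J"
    using f(2) f'(1) J(2) by auto
  from ideal_diff_mem[OF J(1) this] have fJ: "f \<in> J" by simp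
  define F where "F = hom_comp e f"
  have F: "F \<notin> degree_form_ideal I"
  proof
    assume "F \<in> degree_form_ideal I"
    then obtain g where g: "g \<in> I" "degree_le e g" "hom_comp e g = hom_comp e F"
      unfolding degree_form_ideal_iff[OF I(1)] by blast
    have 0: "hom_comp e (f - g) = 0"
      using g(3) by (simp add: F_def hom_comp_hom_comp hom_comp_diff)
    have le: "degree_le e (f - g)"
      by (rule degree_le_diff[OF f(1) g(2)])
    have f'g: "f' - (f - g) \<in> I"
      using ideal_add_mem[OF I(1) f(2) g(1)] by (simp add: algebra_simps)
    show False
    \<comment> \<open>In degree 0 there is no smaller bound to reach; there \<open>f - g\<close>
      vanishes outright, which puts \<open>f'\<close> in \<open>I\<close>.\<close>
    proof (cases e)
      case 0
      then have "f - g = 0"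
        using mpoly_eq_sum_hom_comp[OF le] \<open>hom_comp e (f - g) = 0\<close> by simp
      then show False using f'g f'(1) by simp
    next
      case (Suc e')
      then have "degree_le e' (f - g)"
        using le 0 degree_le_Suc_iff by blast
      then have "ord_mod I f' \<le> e'"
        using f'g by (rule ord_mod_le)
      then show False using f'(2) Suc by simp
    qed
  qed
  have socle: "Poly_Mapping.single (Poly_Mapping.single x 1) 1 * F \<in> degree_form_ideal I" for x
  proof -
    let ?x = "Poly_Mapping.single (Poly_Mapping.single x 1) 1"
    \<comment> \<open>The maximum ranges over \<open>J - I\<close> only; products that fall into
      \<open>I\<close> are represented by 0.\<close>
    obtain q where q: "degree_le e q" "?x * f - q \<in> I"
    proof (cases "?x * f \<in> I")
      case True
      then show ?thesis using that[of 0] by simp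
    next
      case False
      then have "ord_mod I (?x * f) \<le> e"
        unfolding e_def using ideal_mult_mem[OF J(1) fJ] by (intro Max_ge[OF fin] imageI) auto
      then show ?thesis
        using ord_mod_witness[OF I(1), of "?x * f"] degree_le_mono that by metis
    qed
    \<comment> \<open>In degree \<open>Suc e\<close> the polynomial \<open>q\<close> contributes
      nothing, so the component there is \<open>?x * F\<close>.\<close>
    have "degree_le (Suc e) (?x * f - q)"
      using degree_le_mult[OF degree_le_single f(1), of "Poly_Mapping.single x 1" 1 1] q(1)
      by (intro degree_le_diff) (auto intro: degree_le_mono)
    then have "hom_comp (Suc e) (?x * f - q) \<in> degree_form_ideal I"
      by (rule hom_comp_mem_degree_form_ideal[OF I(1) q(2)])
    then show ?thesis
      using hom_comp_eq_0[OF q(1), of "Suc e"]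
      by (simp add: hom_comp_diff hom_comp_single_mult F_def)
  qed
  have "reg_index (degree_form_ideal I) = int (ord_mod (degree_form_ideal I) F)"
    by (rule CBP_imp_ord_socle[where d = d])
      (use CBP F socle ideal_degree_form_ideal lookup_0_degree_form_ideal[OF I]
        single_mem_degree_form_ideal[OF I(1) d] in \<open>auto simp: strict_CBP_def\<close>)
  \<comment> \<open>\<open>F\<close> is homogeneous of degree \<open>e\<close>. For a representative
    \<open>q\<close> of lower degree, \<open>F\<close> would be a component of \<open>F - q\<close>
    and so lie in the homogeneous ideal DF(I).\<close>
  moreover have "ord_mod (degree_form_ideal I) F = e"
  proof (rule antisym)
    show "ord_mod (degree_form_ideal I) F \<le> e"
      using ideal_zero_mem[OF ideal_degree_form_ideal[of I]]
      by (intro ord_mod_le[of _ F]) (auto simp: F_def)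
    show "e \<le> ord_mod (degree_form_ideal I) F"
    proof (rule ccontr)
      assume less: "\<not> e \<le> ord_mod (degree_form_ideal I) F"
      obtain q where q: "degree_le (ord_mod (degree_form_ideal I) F) q"
        "F - q \<in> degree_form_ideal I"
        using ord_mod_witness[OF ideal_degree_form_ideal] by blast
      have "hom_comp e (F - q) \<in> degree_form_ideal I"
        by (rule degree_form_ideal_homogeneous[OF I(1) q(2)])
      then show False
        using F hom_comp_eq_0[OF q(1), of e] less
        by (simp add: F_def hom_comp_diff hom_comp_hom_comp)
    qed
  qed
  moreover have "Max ((\<lambda>p. int (ord_mod I p)) ` (J - I)) = int e"
    using mono_Max_commute[of int, OF _ fin ne] by (simp add: e_def mono_def image_image)
  ultimately show ?thesis
    using reg_index_ideal_image_in[OF I(1)] reg_index_degree_form_ideal[OF zd] by simp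
qed

text \<open>Spanning degrees pass to larger ideals. Finite dimension of the residue field ensures
  that \<open>kdim\<close> is a genuine, nonzero number there.\<close>

lemma zero_dimensional_radical:
  assumes zd: "zero_dimensional I" and Q: "ideal Q poly_ring" "Q \<noteq> UNIV" "I \<subseteq> Q"
  shows "zero_dimensional (radical poly_ring Q)"
proof -
  have "1 \<notin> radical poly_ring Q"
    using ideal_ne_carrier_iff[OF Q(1)] Q(2) by (simp add: radical_def)
  moreover have "Q \<subseteq> radical poly_ring Q"
    by (auto simp: radical_def intro: exI[of _ 1])
  then have "degree_spanning d I \<Longrightarrow> degree_spanning d (radical poly_ring Q)" for d
    using Q(3) unfolding degree_spanning_def by blast
  ultimately show ?thesis
    using zd ideal_radical[OF Q(1)] by (auto simp: zero_dimensional_iff)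
qed

theorem proposition6p10:
  fixes I :: "(('x::finite \<Rightarrow>\<^sub>0 nat) \<Rightarrow>\<^sub>0 'k::field) set"
  assumes "zero_dimensional I"
    and "strict_CBP I"
  shows "CBP I"
  unfolding CBP_def
proof (intro allI impI ballI)
  fix \<Q> Q J
  assume dec: "primary_decomposition poly_ring I \<Q>" and "Q \<in> \<Q>"
    and "minimal_Q_divisor I \<Q> Q J"
  then obtain Q' where Q': "ideal Q' poly_ring" "Q \<subset> Q'" "J = Q' \<inter> \<Inter>(\<Q> - {Q})"
    and dim: "kdim I (image_in I J) =
      kdim (radical poly_ring Q) (carrier (quot_alg (radical poly_ring Q)))"
    by (auto simp: minimal_Q_divisor_def Q_divisor_def Let_def)
  note I = zero_dimensionalD[OF assms(1)]
  have ideals: "\<And>Q. Q \<in> \<Q> \<Longrightarrow> ideal Q poly_ring \<and> Q \<noteq> UNIV" and "I = \<Inter>\<Q>"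
    using dec by (auto simp: primary_decomposition_def primary_ideal_def)
  then have "I \<subseteq> Q" "I \<subseteq> J"
    using \<open>Q \<in> \<Q>\<close> Q' by auto
  have "J = \<Inter>(insert Q' (\<Q> - {Q}))"
    using Q'(3) by simp
  then have "ideal J poly_ring"
    using ideal_Inter[of "insert Q' (\<Q> - {Q})"] ideals Q'(1) by blast
  \<comment> \<open>If they were equal, the image of \<open>J\<close> would have dimension 0, but
    minimality makes it the dimension of the residue field.\<close>
  moreover have "J \<noteq> I"
  proof
    assume "J = I"
    then have "image_in I J = {I}"
      using a_r_coset_zero[OF I(1)] ideal_zero_mem[OF I(1)] unfolding image_in_def by blast
    then have "kdim I (image_in I J) = 0"
      using kdim_zero[OF I] by simp
    moreover have "zero_dimensional (radical poly_ring Q)"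
      using zero_dimensional_radical[OF assms(1)] ideals \<open>Q \<in> \<Q>\<close> \<open>I \<subseteq> Q\<close> by blast
    ultimately show False
      using dim kdim_carrier_ne_0 by metis
  qed
  ultimately show "reg_index_ideal I (image_in I J) = reg_index I"
    using strict_CBP_imp_reg_index_ideal[OF assms] \<open>I \<subseteq> J\<close> by blast
qed

end
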